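(* For all integers $r \geq 1$, we have $$\tilde{m}_2(r) \,\leq\, 2^{r-1} + 2^{\lfloor r/2 \rfloor} \,=\, (1+o(1))\,2^{r-1},$$ where $o(1)$ denotes a quantity tending to $0$ as $r \to \infty$.
   Context: A hypergraph $\mathcal{H}$ on a set $X$ (of vertices) is a collection of subsets of $X$, called edges; it is $r$-uniform if every edge has exactly $r$ elements. $|\mathcal{H}|$ is the number of edges. Each nonnegative integer $k$ is identified with the set $\{0,\dots,k-1\}$. Functions are identified with their graphs, so $\subseteq$, $\cap$ may be applied to functions. $[X \rightharpoonup k]$ denotes the set of all partial maps from $X$ to $k$, i.e. functions $\varphi$ defined on a subset $\mathrm{dom}(\varphi)$ of $X$ with values in $k$. For $\mathcal{F} \subseteq [X \rightharpoonup k]$, $\mathrm{dom}(\mathcal{F}) := \{\mathrm{dom}(\varphi) : \varphi \in \mathcal{F}\}$. An $\mathcal{F}$-coloring is a (total) function $f \colon X \to k$ such that $\varphi \not\subseteq f$ for all $\varphi \in \mathcal{F}$. A $k$-fold cover of a hypergraph $\mathcal{H}$ on $X$ is a family $\mathcal{F} \subseteq [X \rightharpoonup k]$ such that $\mathrm{dom}(\mathcal{F}) \subseteq \mathcal{H}$ and, whenever $\varphi, \psi \in \mathcal{F}$ are distinct with $\mathrm{dom}(\varphi) = \mathrm{dom}(\psi)$, we have $\varphi \cap \psi = \varnothing$ (i.e. $\varphi(x)\neq\psi(x)$ for every $x$ in the common domain). A hypergraph $\mathcal{H}$ is $k$-DP-colorable if every $k$-fold cover $\mathcal{F}$ of $\mathcal{H}$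 admits an $\mathcal{F}$-coloring. For integers $r,k\ge 1$, $\tilde{m}_k(r)$ denotes the minimum $|\mathcal{H}|$ over all $r$-uniform hypergraphs $\mathcal{H}$ that are not $k$-DP-colorable. *)

theory Defs
  imports Complex_Main "HOL-Library.Extended_Nat"
begin

text \<open>
  A hypergraph on a vertex set \<open>X\<close> is given by its set \<open>H\<close> of edges. The number \<open>k\<close> stands for
  the set \<open>{..<k}\<close>, and partial maps from \<open>X\<close> to \<open>k\<close> are HOL maps, whose graphs are compared by
  \<open>\<subseteq>\<^sub>m\<close> and intersected through \<open>Map.graph\<close>.
\<close>

definition hypergraph_on :: "'a set \<Rightarrow> 'a set set \<Rightarrow> bool" where
  "hypergraph_on X H \<longleftrightarrow> H \<subseteq> Pow X"

definition uniform :: "nat \<Rightarrow> 'a set set \<Rightarrow> bool" where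
  "uniform r H \<longleftrightarrow> (\<forall>e\<in>H. finite e \<and> card e = r)"

definition partial_maps :: "'a set \<Rightarrow> nat \<Rightarrow> ('a \<rightharpoonup> nat) set" where
  "partial_maps X k = {\<phi>. dom \<phi> \<subseteq> X \<and> ran \<phi> \<subseteq> {..<k}}"

definition total_maps :: "'a set \<Rightarrow> nat \<Rightarrow> ('a \<rightharpoonup> nat) set" where
  "total_maps X k = {f. dom f = X \<and> ran f \<subseteq> {..<k}}"

definition is_coloring :: "'a set \<Rightarrow> nat \<Rightarrow> ('a \<rightharpoonup> nat) set \<Rightarrow> ('a \<rightharpoonup> nat) \<Rightarrow> bool" where
  "is_coloring X k F f \<longleftrightarrow> f \<in> total_maps X k \<and> (\<forall>\<phi>\<in>F. \<not> \<phi> \<subseteq>\<^sub>m f)"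

definition fold_cover :: "'a set \<Rightarrow> 'a set set \<Rightarrow> nat \<Rightarrow> ('a \<rightharpoonup> nat) set \<Rightarrow> bool" where
  "fold_cover X H k F \<longleftrightarrow>
     F \<subseteq> partial_maps X k \<and> dom ` F \<subseteq> H \<and>
     (\<forall>\<phi>\<in>F. \<forall>\<psi>\<in>F. \<phi> \<noteq> \<psi> \<and> dom \<phi> = dom \<psi> \<longrightarrow> Map.graph \<phi> \<inter> Map.graph \<psi> = {})"

definition DP_colorable :: "'a set \<Rightarrow> 'a set set \<Rightarrow> nat \<Rightarrow> bool" where
  "DP_colorable X H k \<longleftrightarrow> (\<forall>F. fold_cover X H k F \<longrightarrow> (\<exists>f. is_coloring X k F f))"

definition num_edges :: "'a set set \<Rightarrow> enat" where
  "num_edges H = (if finite H then enat (card H) else \<infinity>)"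

text \<open>
  The minimum is taken in \<^typ>\<open>enat\<close>, where a nonempty infimum is attained and the infimum of the
  empty set is \<open>\<infinity>\<close>; so a finite upper bound entails that a hypergraph as required exists.
  Vertices are natural numbers; by \<open>min_non_DP_colorable_le\<close> below this loses no generality.
\<close>

definition min_non_DP_colorable :: "nat \<Rightarrow> nat \<Rightarrow> enat" where
  "min_non_DP_colorable k r =
     Inf {num_edges H | (X :: nat set) H.
            hypergraph_on X H \<and> uniform r H \<and> \<not> DP_colorable X H k}"

lemma min_non_DP_colorable_le:
  fixes X :: "'a set"
  assumes hyp: "hypergraph_on X H" and uni: "uniform r H" and nc: "\<not> DP_colorable X H k"
    and k: "k \<ge> 1"
  shows "min_non_DP_colorable k r \<le> num_edges H"
proof (cases "finite H")
  case False
  then show ?thesis by (simp add: num_edges_def)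
next
  case True
  define Y where "Y = \<Union>H"
  have "finite Y" using True uni by (auto simp: Y_def uniform_def)
  then obtain g :: "'a \<Rightarrow> nat" where g: "inj_on g Y"
    by (metis finite_imp_inj_to_nat_seg)
  have YX: "Y \<subseteq> X" using hyp by (auto simp: Y_def hypergraph_on_def)
  define h where "h = inv_into Y g"
  have hg: "h (g x) = x" if "x \<in> Y" for x using that g by (simp add: h_def)
  define H' where "H' = (`) g ` H"
  define X' where "X' = g ` Y"
  have hX': "h y \<in> Y" "g (h y) = y" if "y \<in> X'" for y
    using that hg by (auto simp: X'_def)
  have hyp': "hypergraph_on X' H'"
    by (auto simp: hypergraph_on_def X'_def H'_def Y_def)
  have eY: "e \<subseteq> Y" if "e \<in> H" for e using that by (auto simp: Y_def)
  have uni': "uniform r H'"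
    unfolding uniform_def
  proof
    fix e' assume "e' \<in> H'"
    then obtain e where e: "e \<in> H" "e' = g ` e" by (auto simp: H'_def)
    have "card e' = card e" using e eY[OF e(1)] g by (metis card_image inj_on_subset)
    then show "finite e' \<and> card e' = r" using e uni by (simp add: uniform_def)
  qed
  have inj: "inj_on ((`) g) H"
    using inj_on_image_eq_iff[OF g] eY by (intro inj_onI) blast
  have card': "num_edges H' = num_edges H"
    using True inj by (simp add: num_edges_def H'_def card_image)
  have nc': "\<not> DP_colorable X' H' k"
  proof
    assume dp: "DP_colorable X' H' k"
    have "DP_colorable X H k" unfolding DP_colorable_def
    proof (intro allI impI)
      fix F assume F: "fold_cover X H k F"
      define T where "T = (\<lambda>\<phi> :: 'a \<rightharpoonup> nat. (\<lambda>y. if y \<in> X' then \<phi> (h y) else None))"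
      have domH: "dom \<phi> \<in> H" if "\<phi> \<in> F" for \<phi> using F that by (auto simp: fold_cover_def)
      have domY: "dom \<phi> \<subseteq> Y" if "\<phi> \<in> F" for \<phi> using domH[OF that] eY by blast
      have Tg: "T \<phi> (g x) = \<phi> x" if "x \<in> Y" for \<phi> x
        using that hg by (simp add: T_def X'_def)
      have domT: "dom (T \<phi>) = g ` dom \<phi>" if "\<phi> \<in> F" for \<phi>
      proof
        show "dom (T \<phi>) \<subseteq> g ` dom \<phi>"
        proof
          fix y assume "y \<in> dom (T \<phi>)"
          then have y: "y \<in> X'" "\<phi> (h y) \<noteq> None" by (auto simp: T_def split: if_splits)
          then show "y \<in> g ` dom \<phi>" using hX'(2)[OF y(1)] by (metis domIff image_eqI)
        qed
        show "g ` dom \<phi> \<subseteq> dom (T \<phi>)"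
        proof
          fix y assume "y \<in> g ` dom \<phi>"
          then obtain x where x: "x \<in> dom \<phi>" "y = g x" by blast
          then have "T \<phi> y = \<phi> x" using domY[OF that] Tg by blast
          then show "y \<in> dom (T \<phi>)" using x(1) by (simp add: domIff)
        qed
      qed
      have ranT: "ran (T \<phi>) \<subseteq> ran \<phi>" for \<phi>
        by (auto simp: T_def ran_def split: if_splits)
      have cov: "fold_cover X' H' k (T ` F)"
        unfolding fold_cover_def
      proof (intro conjI ballI impI)
        show "T ` F \<subseteq> partial_maps X' k"
        proof
          fix \<chi> assume "\<chi> \<in> T ` F"
          then obtain \<phi> where p: "\<phi> \<in> F" "\<chi> = T \<phi>" by blast
          then have "ran \<phi> \<subseteq> {..<k}" using F by (auto simp: fold_cover_def partial_maps_def)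
          then show "\<chi> \<in> partial_maps X' k"
            using ranT[of \<phi>] domT[OF p(1)] domY[OF p(1)] p(2)
            unfolding partial_maps_def X'_def by auto
        qed
        show "dom ` T ` F \<subseteq> H'" using domT domH by (auto simp: H'_def)
        fix a b assume "a \<in> T ` F" "b \<in> T ` F" and ab: "a \<noteq> b \<and> dom a = dom b"
        then obtain \<phi> \<psi> where p: "\<phi> \<in> F" "\<psi> \<in> F" "a = T \<phi>" "b = T \<psi>" by blast
        have "g ` dom \<phi> = g ` dom \<psi>" using ab p domT by simp
        then have "dom \<phi> = dom \<psi>" using inj_on_image_eq_iff[OF g domY[OF p(1)] domY[OF p(2)]] by simp
        moreover have "\<phi> \<noteq> \<psi>" using ab p by auto
        ultimately have d: "Map.graph \<phi> \<inter> Map.graph \<psi> = {}"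
          using F p by (auto simp: fold_cover_def)
        show "Map.graph a \<inter> Map.graph b = {}"
        proof (rule ccontr)
          assume "Map.graph a \<inter> Map.graph b \<noteq> {}"
          then obtain y v where "a y = Some v" "b y = Some v"
            by (auto simp: Map.graph_def)
          then have "\<phi> (h y) = Some v" "\<psi> (h y) = Some v"
            using p by (auto simp: T_def split: if_splits)
          then show False using d by (auto simp: Map.graph_def)
        qed
      qed
      then obtain f' where f': "is_coloring X' k (T ` F) f'"
        using dp by (auto simp: DP_colorable_def)
      define f where "f = (\<lambda>x. if x \<in> Y then f' (g x) else if x \<in> X then Some 0 else None)"
      have domf': "dom f' = X'" "ran f' \<subseteq> {..<k}"
        using f' by (auto simp: is_coloring_def total_maps_def)
      have "dom f = X"
      proof -
        have "f' (g x) \<noteq> None" if "x \<in> Y" for x using that domf'(1) by (auto simp: X'_def)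
        then have "f x \<noteq> None \<longleftrightarrow> x \<in> X" for x using YX by (auto simp: f_def)
        then show ?thesis by (simp add: dom_def)
      qed
      moreover have "ran f \<subseteq> {..<k}"
        using domf'(2) k by (auto simp: f_def ran_def split: if_splits)
      moreover have "\<not> \<phi> \<subseteq>\<^sub>m f" if p: "\<phi> \<in> F" for \<phi>
      proof
        assume le: "\<phi> \<subseteq>\<^sub>m f"
        have "T \<phi> \<subseteq>\<^sub>m f'" unfolding map_le_def
        proof
          fix y assume "y \<in> dom (T \<phi>)"
          then obtain x where x: "x \<in> dom \<phi>" "y = g x" using domT[OF p] by auto
          then have "x \<in> Y" using domY[OF p] by auto
          then show "T \<phi> y = f' y" using x le Tg by (simp add: map_le_def f_def)
        qed
        then show False using f' p by (auto simp: is_coloring_def)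
      qed
      ultimately show "\<exists>f. is_coloring X k F f"
        unfolding is_coloring_def total_maps_def by blast
    qed
    then show False using nc by simp
  qed
  have "num_edges H' \<in> {num_edges H | (X :: nat set) H.
            hypergraph_on X H \<and> uniform r H \<and> \<not> DP_colorable X H k}"
    using hyp' uni' nc' by blast
  then have "min_non_DP_colorable k r \<le> num_edges H'"
    unfolding min_non_DP_colorable_def by (rule Inf_lower)
  then show ?thesis using card' by simp
qed

end

theory Submission
  imports Defs
begin

text \<open>
  An edge \<open>e\<close> admits at most two disjoint total maps into \<open>2\<close>, a pattern \<open>p\<close> and its complement, and
  together they forbid the colorings that agree with \<open>p\<close> on \<open>e\<close> up to a global swap of the two
  colors. So what is wanted is a family of distinct \<open>r\<close>-sets, each with a pattern, such that every
  coloring agrees up to swap with one of the patterns. One edge forbids a fraction \<open>2 ^ (1 - r)\<close> of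
  all colorings, hence \<open>2 ^ (r - 1)\<close> edges can suffice only if they overlap very little.

  Put \<open>n = r - 1\<close> and take one vertex \<open>Root\<close> and \<open>n\<close> layers of two vertices \<open>Node k False\<close>,
  \<open>Node k True\<close>, for \<open>k < n\<close>. Read the color of a vertex relative to \<open>Root\<close>; then a coloring turns
  layer \<open>k\<close> into a map \<open>t k\<close> from bits to bits, which sends \<open>b\<close> to the color of \<open>Node k b\<close>. Walking
  through the layers, from \<open>b\<close> in layer \<open>k\<close> to \<open>t k b\<close> in layer \<open>k + 1\<close>, composes these maps. If the
  composition has a fixed point, the walk starting there is a closed cycle. A cycle visits one vertex
  per layer, and since the end of the walk is glued to its beginning, the visited vertices
  \<open>xs ! 0, \<dots>, xs ! (n - 1)\<close> alone determine every color along it: layer \<open>k\<close> must send \<open>xs ! k\<close> to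
  its cyclic successor. So each of the \<open>2 ^ n\<close> bit strings \<open>xs\<close> gives one edge, of size \<open>n + 1 = r\<close>,
  with one pattern, and no set is used twice. A coloring escapes all of these only if the
  composition has no fixed point, and this forces all \<open>t k\<close> to be bijections: a single constant
  layer makes the composition constant. Thus in a coloring that escapes, the two vertices of each
  layer have opposite colors (\<open>complies_cyclic_edge\<close>).

  On these few colorings a layer carries one bit of information, while an edge may spend two
  vertices on it. An edge made of about \<open>r / 2\<close> full layers therefore forbids a fraction of
  about \<open>2 ^ (- r / 2)\<close> of them, and \<open>2 ^ (r div 2)\<close> edges are enough: these are the leaves of
  a decision tree that queries the layer bits one after another (\<open>complies_tree_edge\<close>). To make the
  leaves differ as sets, the layer queried depends on the previous answer, and the last answer is
  recorded in which single vertex of the last layer is taken. Each of these edges contains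
  a full layer when \<open>r \<ge> 3\<close>, which separates it from the cyclic edges.
\<close>

section \<open>Edges with patterns and two-fold covers\<close>

text \<open>
  The bit \<open>c\<close> selects the pattern or its complement; both are forbidden at the price of one edge.
\<close>

definition complies :: "('v \<Rightarrow> bool) \<Rightarrow> ('v \<Rightarrow> bool) \<Rightarrow> 'v set \<Rightarrow> bool" where
  "complies g p e \<longleftrightarrow> (\<exists>c. \<forall>v\<in>e. g v = (p v \<noteq> c))"

text \<open>
  The cover consists of the restrictions of each pattern and of its complement to the edge. Two
  members with the same domain come from the same index because \<open>e\<close> is injective, so they are
  complementary and their graphs are disjoint. Injectivity is what makes this a \<open>2\<close>-fold cover.
\<close>

lemma min_non_DP_colorable_le_card:
  fixes e :: "'i \<Rightarrow> 'v set" and p :: "'i \<Rightarrow> 'v \<Rightarrow> bool"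
  assumes fin: "finite I" and inj: "inj_on e I"
    and uni: "\<And>i. i \<in> I \<Longrightarrow> finite (e i) \<and> card (e i) = r"
    and hit: "\<And>g. \<exists>i\<in>I. complies g (p i) (e i)"
  shows "min_non_DP_colorable 2 r \<le> enat (card I)"
proof -
  define H where "H = e ` I"
  define \<Phi> where "\<Phi> = (\<lambda>(i, c). (\<lambda>v. Some (of_bool (p i v \<noteq> c))) |` e i :: 'v \<rightharpoonup> nat)"
  define F where "F = \<Phi> ` (I \<times> UNIV)"
  have dom: "dom (\<Phi> (i, c)) = e i" for i c by (auto simp: \<Phi>_def)
  have val: "\<Phi> (i, c) v = Some (of_bool (p i v \<noteq> c))" if "v \<in> e i" for i c v
    using that by (simp add: \<Phi>_def)
  have "fold_cover UNIV H 2 F"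
    unfolding fold_cover_def
  proof (intro conjI ballI impI)
    show "F \<subseteq> partial_maps UNIV 2"
      by (auto simp: F_def partial_maps_def \<Phi>_def ran_def restrict_map_def split: if_splits)
    show "dom ` F \<subseteq> H" by (auto simp: F_def H_def dom)
    fix \<phi> \<psi> assume "\<phi> \<in> F" "\<psi> \<in> F" and *: "\<phi> \<noteq> \<psi> \<and> dom \<phi> = dom \<psi>"
    then obtain i c j d where ij: "i \<in> I" "j \<in> I" "\<phi> = \<Phi> (i, c)" "\<psi> = \<Phi> (j, d)"
      by (auto simp: F_def)
    have "i = j" using * ij inj dom by (auto dest: inj_onD)
    then have "c \<noteq> d" using * ij by auto
    have "\<phi> v \<noteq> \<psi> v" if "v \<in> e i" for v
      using that \<open>i = j\<close> \<open>c \<noteq> d\<close> ij val[of v i] by auto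
    then have "\<not> (\<phi> v = Some x \<and> \<psi> v = Some x)" for v x
      using dom[of i c] ij(3) by (metis domI)
    then show "Map.graph \<phi> \<inter> Map.graph \<psi> = {}"
      unfolding Map.graph_def by blast
  qed
  moreover have "\<not> is_coloring UNIV 2 F f" for f
  proof
    assume f: "is_coloring UNIV 2 F f"
    then have tot: "dom f = UNIV" "ran f \<subseteq> {..<2}" and avoid: "\<And>\<phi>. \<phi> \<in> F \<Longrightarrow> \<not> \<phi> \<subseteq>\<^sub>m f"
      by (auto simp: is_coloring_def total_maps_def)
    have fv: "f v = Some (of_bool (f v = Some 1))" for v
    proof -
      obtain x where x: "f v = Some x" using tot(1) by (auto simp: dom_def)
      then have "x < 2" using tot(2) by (auto simp: ran_def)
      then show ?thesis using x by (auto simp: less_2_cases_iff)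
    qed
    obtain i c where i: "i \<in> I" and c: "\<forall>v\<in>e i. (f v = Some 1) = (p i v \<noteq> c)"
      using hit[of "\<lambda>v. f v = Some 1"] by (auto simp: complies_def)
    have "\<Phi> (i, c) \<subseteq>\<^sub>m f"
      unfolding map_le_def dom
    proof
      fix v assume v: "v \<in> e i"
      then show "\<Phi> (i, c) v = f v" using c fv[of v] val[OF v] by simp
    qed
    then show False using avoid i by (auto simp: F_def)
  qed
  ultimately have "\<not> DP_colorable UNIV H 2" by (auto simp: DP_colorable_def)
  then have "min_non_DP_colorable 2 r \<le> num_edges H"
    using uni by (intro min_non_DP_colorable_le[of UNIV])
      (auto simp: hypergraph_on_def uniform_def H_def)
  also have "\<dots> = enat (card I)"
    using fin inj by (simp add: num_edges_def H_def card_image)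
  finally show ?thesis .
qed

section \<open>Walks through Boolean layers\<close>

primrec walk :: "(nat \<Rightarrow> bool \<Rightarrow> bool) \<Rightarrow> bool \<Rightarrow> nat \<Rightarrow> bool" where
  "walk t c 0 = c"
| "walk t c (Suc k) = t k (walk t c k)"

text \<open>
  A constant layer erases the memory of the starting bit, and walks that have met stay together.
\<close>

lemma walk_merge:
  assumes "t k True = t k False" "k < n"
  shows "walk t c n = walk t d n"
  using assms(2)
proof (induction n)
  case (Suc n)
  show ?case
  proof (cases "k = n")
    case True
    then show ?thesis using assms(1) by (cases "walk t c n"; cases "walk t d n") auto
  next
    case False
    then have "walk t c n = walk t d n" using Suc by simp
    then show ?thesis by simp
  qed
qed simp

section \<open>The cyclic edges\<close>

datatype vertex = Root | Node nat bool

definition cyclic_edge :: "bool list \<Rightarrow> vertex set" where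
  "cyclic_edge xs = insert Root ((\<lambda>k. Node k (xs ! k)) ` {..<length xs})"

text \<open>
  The bit that the walk carries into the next layer is the color it has just read. The last layer
  hands its color back to layer \<open>0\<close>; this is the index modulo the length.
\<close>

primrec cyclic_pattern :: "bool list \<Rightarrow> vertex \<Rightarrow> bool" where
  "cyclic_pattern xs Root = False"
| "cyclic_pattern xs (Node k b) = (xs ! (Suc k mod length xs))"

lemma card_cyclic_edge: "finite (cyclic_edge xs) \<and> card (cyclic_edge xs) = Suc (length xs)"
proof -
  have "inj_on (\<lambda>k. Node k (xs ! k)) {..<length xs}" by (auto intro: inj_onI)
  then show ?thesis
    by (simp add: cyclic_edge_def card_insert_if card_image image_iff)
qed

lemma Node_in_cyclic_edge [simp]:
  "Node k b \<in> cyclic_edge xs \<longleftrightarrow> k < length xs \<and> b = xs ! k"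
  by (auto simp: cyclic_edge_def)

lemma inj_on_cyclic_edge: "inj_on cyclic_edge {xs. length xs = n}"
proof (rule inj_onI)
  fix xs ys assume *: "xs \<in> {xs. length xs = n}" "ys \<in> {xs. length xs = n}"
    "cyclic_edge xs = cyclic_edge ys"
  show "xs = ys"
  proof (rule nth_equalityI)
    show "length xs = length ys" using * by simp
    fix k assume "k < length xs"
    then have "Node k (xs ! k) \<in> cyclic_edge ys" using *(3) by (metis Node_in_cyclic_edge)
    then show "xs ! k = ys ! k" by simp
  qed
qed

text \<open>
  Layer \<open>k\<close> is constant, so all walks end with the same bit \<open>c\<close>; the walk that starts with \<open>c\<close>
  closes up and names a cyclic edge whose pattern the coloring follows.
\<close>

lemma complies_cyclic_edge:
  assumes "g (Node k True) = g (Node k False)" "k < n"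
  shows "\<exists>xs. length xs = n \<and> complies g (cyclic_pattern xs) (cyclic_edge xs)"
proof -
  define t where "t = (\<lambda>k b. g (Node k b) \<noteq> g Root)"
  define c where "c = walk t True n"
  have closed: "walk t c n = c"
    using walk_merge[of t k n c True] assms by (simp add: t_def c_def)
  define xs where "xs = map (walk t c) [0..<n]"
  have len: "length xs = n" by (simp add: xs_def)
  have step: "xs ! (Suc j mod n) = t j (xs ! j)" if "j < n" for j
  proof (cases "Suc j = n")
    case True
    then show ?thesis using that closed by (auto simp: xs_def)
  next
    case False
    then show ?thesis using that by (simp add: xs_def)
  qed
  have "g v = (cyclic_pattern xs v \<noteq> g Root)" if "v \<in> cyclic_edge xs" for v
    using that step len by (cases v) (auto simp: t_def)
  then show ?thesis using len unfolding complies_def by blast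
qed

text \<open>
  It remains to forbid the colorings in which every layer is bicolored. Edges that contain a full
  layer may be added freely for this, as no cyclic edge contains one.
\<close>

lemma min_non_DP_colorable_le_cyclic_plus:
  fixes e :: "'i \<Rightarrow> vertex set" and p :: "'i \<Rightarrow> vertex \<Rightarrow> bool"
  assumes fin: "finite J" and inj: "inj_on e J"
    and uni: "\<And>j. j \<in> J \<Longrightarrow> finite (e j) \<and> card (e j) = Suc n"
    and pair: "\<And>j. j \<in> J \<Longrightarrow> \<exists>k. Node k True \<in> e j \<and> Node k False \<in> e j"
    and hit: "\<And>g. (\<And>k. k < n \<Longrightarrow> g (Node k True) \<noteq> g (Node k False)) \<Longrightarrow>
               \<exists>j\<in>J. complies g (p j) (e j)"
  shows "min_non_DP_colorable 2 (Suc n) \<le> enat (2 ^ n + card J)"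
proof -
  define I where "I = {xs :: bool list. length xs = n}"
  have cardI: "card I = 2 ^ n" "finite I"
    using card_lists_length_eq[of "UNIV :: bool set" n] finite_lists_length_eq[of "UNIV :: bool set" n]
    by (auto simp: I_def)
  have apart: "cyclic_edge xs \<noteq> e j" if "j \<in> J" for xs j
    using pair[OF that] by (metis Node_in_cyclic_edge)
  have "min_non_DP_colorable 2 (Suc n) \<le> enat (card (I <+> J))"
  proof (rule min_non_DP_colorable_le_card[where e = "case_sum cyclic_edge e"
        and p = "case_sum cyclic_pattern p"])
    show "finite (I <+> J)" using fin cardI by simp
    show "inj_on (case_sum cyclic_edge e) (I <+> J)"
    proof (rule inj_onI)
      fix i i' assume "i \<in> I <+> J" "i' \<in> I <+> J"
        "case_sum cyclic_edge e i = case_sum cyclic_edge e i'"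
      then show "i = i'"
        using apart apart[symmetric] inj_onD[OF inj] inj_onD[OF inj_on_cyclic_edge[of n]]
        by (cases i; cases i') (auto simp: I_def)
    qed
    show "finite (case_sum cyclic_edge e i) \<and> card (case_sum cyclic_edge e i) = Suc n"
      if "i \<in> I <+> J" for i
      using that uni card_cyclic_edge by (auto simp: I_def)
    fix g
    show "\<exists>i\<in>I <+> J. complies g (case_sum cyclic_pattern p i) (case_sum cyclic_edge e i)"
    proof (cases "\<exists>k<n. g (Node k True) = g (Node k False)")
      case True
      then obtain xs where "xs \<in> I" "complies g (cyclic_pattern xs) (cyclic_edge xs)"
        using complies_cyclic_edge[of g _ n] by (auto simp: I_def)
      then show ?thesis by (intro bexI[of _ "Inl xs"]) auto
    next
      case False
      then obtain j where "j \<in> J" "complies g (p j) (e j)" using hit[of g] by auto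
      then show ?thesis by (intro bexI[of _ "Inr j"]) auto
    qed
  qed
  then show ?thesis using fin cardI by (simp add: card_Plus)
qed

section \<open>The remaining colorings\<close>

text \<open>
  The layer of the \<open>i\<close>-th query, when \<open>ds\<close> lists the answers: layer \<open>0\<close> first, then one of the layers
  \<open>2 * i - 1\<close> and \<open>2 * i\<close>, selected by the answer before. For \<open>i = 0\<close> there is no earlier answer,
  and the truncated subtraction gives \<open>0\<close> whatever \<open>ds ! 0\<close> is.
  A tree of depth \<open>m\<close> thus uses the layers below \<open>2 * m - 1\<close>.
\<close>

definition level :: "bool list \<Rightarrow> nat \<Rightarrow> nat" where
  "level ds i = 2 * i - of_bool (ds ! (i - 1))"

text \<open>
  Vertices against which the answers are measured, since patterns matter only up to swap. For
  \<open>r = 2 * m\<close> there are just \<open>2 * m - 1\<close> layers, all of which the tree uses, and \<open>Root\<close> is the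
  reference. For \<open>r = 2 * m + 1\<close> there is one more layer, \<open>r - 2 = 2 * m - 1\<close>; its two vertices supply
  the additional vertex that an edge of odd size needs.
\<close>

definition reference :: "nat \<Rightarrow> vertex set" where
  "reference r = (if even r then {Root} else range (Node (r - 2)))"

text \<open>
  All queried layers are taken in full, except the last: of it only the vertex named by the last
  answer is taken, so that sibling leaves of the tree get different edges. This makes
  \<open>2 * (m - 1) + 1\<close> vertices in addition to the reference, for \<open>m\<close> queries.
\<close>

definition tree_edge :: "nat \<Rightarrow> bool list \<Rightarrow> vertex set" where
  "tree_edge r ds = reference r \<union>
     {Node (level ds i) b | i b. i < length ds \<and> (Suc i = length ds \<longrightarrow> b = ds ! i)}"

text \<open>
  A vertex of layer \<open>k\<close> can only belong to query \<open>Suc k div 2\<close>, whose answer is the relative color of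
  \<open>Node k False\<close>. When \<open>r\<close> is odd, the reference layer has the index \<open>length ds\<close> in this numbering;
  the appended \<open>False\<close> says that its vertex \<open>Node (r - 2) False\<close> has the reference color.
\<close>

primrec tree_pattern :: "bool list \<Rightarrow> vertex \<Rightarrow> bool" where
  "tree_pattern ds Root = False"
| "tree_pattern ds (Node k b) = ((ds @ [False]) ! (Suc k div 2) \<noteq> b)"

lemma level_index: "Suc (level ds i) div 2 = i"
  by (cases i) (auto simp: level_def)

lemma level_less: "i < m \<Longrightarrow> level ds i < 2 * m - 1"
  by (auto simp: level_def)

lemma card_tree_edge:
  assumes "length ds = r div 2" "r \<ge> 2"
  shows "finite (tree_edge r ds) \<and> card (tree_edge r ds) = r"
proof -
  define m where "m = r div 2 - 1"
  have m: "length ds = Suc m" using assms by (simp add: m_def)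
  define D where "D = {..<m} \<times> (UNIV :: bool set) \<union> {(m, ds ! m)}"
  define h where "h = (\<lambda>(i, b). Node (level ds i) b)"
  have inj: "inj_on h D"
    by (auto simp: h_def inj_on_def) (metis level_index)+
  have D: "finite D" "card D = 2 * m + 1"
    by (auto simp: D_def card_insert_if card_cartesian_product)
  have eq: "tree_edge r ds = reference r \<union> h ` D"
    using m by (force simp: tree_edge_def h_def D_def less_Suc_eq)
  have R: "finite (reference r)" "card (reference r) = (if even r then 1 else 2)"
    by (auto simp: reference_def card_image inj_on_def)
  have "reference r \<inter> h ` D = {}"
  proof (cases "even r")
    case True
    then show ?thesis by (auto simp: reference_def h_def)
  next
    case False
    have "i \<le> m" if "(i, b) \<in> D" for i b using that by (auto simp: D_def)
    moreover have "Suc (r - 2) div 2 = Suc m" using False assms by (auto simp: m_def elim!: oddE)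
    ultimately have "level ds i \<noteq> r - 2" if "(i, b) \<in> D" for i b
      using that level_index[of ds i] by fastforce
    then show ?thesis using False unfolding reference_def h_def by fastforce
  qed
  then have "card (tree_edge r ds) = (if even r then 1 else 2) + (2 * m + 1)"
    using R D inj by (simp add: eq card_Un_disjoint card_image)
  also have "\<dots> = r" using assms by (auto simp: m_def elim!: evenE oddE)
  finally show ?thesis using R D by (simp add: eq)
qed

text \<open>
  Query \<open>i\<close> can only go to layers \<open>2 * i - 1\<close> and \<open>2 * i\<close>, which no other query can reach, and an
  edge meets just one of them. So the layer of each query, and at the end the single vertex, can be
  read off the edge; this is why tree edges determine the answers.
\<close>

lemma Node_in_tree_edge:
  assumes "length ds = r div 2" "i < r div 2" "Node (level es i) b \<in> tree_edge r ds"
  shows "level es i = level ds i \<and> (Suc i = r div 2 \<longrightarrow> b = ds ! i)"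
proof -
  have "Node (level es i) b \<notin> reference r"
  proof
    assume "Node (level es i) b \<in> reference r"
    then have "odd r" "level es i = r - 2" by (auto simp: reference_def split: if_splits)
    then show False using level_less[of i "r div 2" es] assms(2) by (auto elim!: oddE)
  qed
  then obtain j where j: "level es i = level ds j" "Suc j = r div 2 \<longrightarrow> b = ds ! j"
    using assms(1,3) by (auto simp: tree_edge_def)
  then have "j = i" using level_index by metis
  then show ?thesis using j by simp
qed

lemma inj_on_tree_edge: "inj_on (tree_edge r) {ds. length ds = r div 2}"
proof (rule inj_onI)
  fix ds es assume "ds \<in> {ds. length ds = r div 2}" "es \<in> {ds. length ds = r div 2}"
    and eq: "tree_edge r ds = tree_edge r es"
  then have len: "length ds = r div 2" "length es = r div 2" by auto
  have key: "level ds i = level es i \<and> (Suc i = r div 2 \<longrightarrow> ds ! i = es ! i)" if "i < r div 2" for i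
  proof -
    have "Node (level ds i) (ds ! i) \<in> tree_edge r ds" using that len by (auto simp: tree_edge_def)
    then show ?thesis using Node_in_tree_edge[OF len(2) that] eq by simp
  qed
  show "ds = es"
  proof (rule nth_equalityI)
    show "length ds = length es" using len by simp
    fix i assume i: "i < length ds"
    \<comment> \<open>All answers but the last show in the choice of the next layer.\<close>
    show "ds ! i = es ! i"
    proof (cases "Suc i = r div 2")
      case True
      then show ?thesis using key i len by simp
    next
      case False
      then have "level ds (Suc i) = level es (Suc i)" using key[of "Suc i"] i len by simp
      then show ?thesis by (cases "ds ! i"; cases "es ! i") (auto simp: level_def)
    qed
  qed
qed

lemma pair_in_tree_edge:
  assumes "length ds = r div 2" "r \<ge> 3"
  shows "\<exists>k. Node k True \<in> tree_edge r ds \<and> Node k False \<in> tree_edge r ds"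
proof (cases "even r")
  case True
  then have "r div 2 \<noteq> 1" "0 < r div 2" using assms by (auto elim!: evenE)
  then have "Node (level ds 0) b \<in> tree_edge r ds" for b
    using assms unfolding tree_edge_def by force
  then show ?thesis by blast
next
  case False
  then show ?thesis by (auto simp: tree_edge_def reference_def)
qed

text \<open>
  Descend the decision tree along the bits \<open>s k\<close> that the coloring gives to its layers, measured
  against the reference color \<open>c\<close>. As the next layer depends only on the last answer, the answers
  form a walk, now with step \<open>i\<close> reading layer \<open>2 * i - of_bool b\<close>.
\<close>

lemma complies_tree_edge:
  assumes opp: "\<And>k. Suc k < r \<Longrightarrow> g (Node k True) \<noteq> g (Node k False)" and r: "r \<ge> 2"
  shows "\<exists>ds. length ds = r div 2 \<and> complies g (tree_pattern ds) (tree_edge r ds)"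
proof -
  define m where "m = r div 2"
  define c where "c = g (if even r then Root else Node (r - 2) False)"
  define s where "s = (\<lambda>k. g (Node k False) \<noteq> c)"
  have s: "g (Node k b) = ((s k \<noteq> b) \<noteq> c)" if "Suc k < r" for k b
    using opp[OF that] by (cases b) (auto simp: s_def)
  define w where "w = walk (\<lambda>i b. s (2 * i - of_bool b)) False"
  define ds where "ds = map (\<lambda>i. w (Suc i)) [0..<m]"
  have len: "length ds = m" by (simp add: ds_def)
  have answer: "ds ! i = s (level ds i)" if "i < m" for i
    using that by (cases i) (auto simp: ds_def w_def level_def)
  have "g v = (tree_pattern ds v \<noteq> c)" if "v \<in> tree_edge r ds" for v
  proof (cases "v \<in> reference r")
    case True
    show ?thesis
    proof (cases "even r")
      case True
      then show ?thesis using \<open>v \<in> reference r\<close> by (auto simp: reference_def c_def)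
    next
      case False
      then obtain b where v: "v = Node (r - 2) b" using True by (auto simp: reference_def)
      have "Suc (r - 2) div 2 = m" using False r by (auto simp: m_def elim!: oddE)
      then have "tree_pattern ds v = b" using len by (simp add: v nth_append)
      moreover have "\<not> s (r - 2)" using False by (simp add: s_def c_def)
      ultimately show ?thesis using s[of "r - 2" b] r by (simp add: v)
    qed
  next
    case False
    then obtain i b where v: "v = Node (level ds i) b" "i < m"
      using \<open>v \<in> tree_edge r ds\<close> len by (auto simp: tree_edge_def)
    have "Suc (level ds i) < r" using level_less[OF v(2), of ds] by (auto simp: m_def)
    then show ?thesis
      using s[of "level ds i" b] answer[OF v(2)] v len by (simp add: level_index nth_append)
  qed
  then show ?thesis using len unfolding complies_def m_def by blast
qed

theorem theorem1p17:
  "(\<forall>r\<ge>1. min_non_DP_colorable 2 r \<le> enat (2 ^ (r - 1) + 2 ^ (r div 2))) \<and>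
   (\<exists>\<epsilon> :: nat \<Rightarrow> real. \<epsilon> \<longlonglongrightarrow> 0 \<and>
      (\<forall>r\<ge>1. 2 ^ (r - 1) + 2 ^ (r div 2) = (1 + \<epsilon> r) * 2 ^ (r - 1)))"
proof (intro conjI allI impI)
  fix r :: nat assume "r \<ge> 1"
  then consider "r = 1" | "r = 2" | "r \<ge> 3" by linarith
  then show "min_non_DP_colorable 2 r \<le> enat (2 ^ (r - 1) + 2 ^ (r div 2))"
  proof cases
    case 1
    have "min_non_DP_colorable 2 1 \<le> enat (card {()})"
      by (rule min_non_DP_colorable_le_card[where e = "\<lambda>_. {()}" and p = "\<lambda>_ _. False"])
        (auto simp: complies_def)
    also have "\<dots> \<le> enat (2 ^ (r - 1) + 2 ^ (r div 2))" using 1 by simp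
    finally show ?thesis using 1 by simp
  next
    case 2
    \<comment> \<open>For \<open>r = 2\<close> tree edges would coincide with cyclic ones; the only layer itself does instead.\<close>
    have "min_non_DP_colorable 2 (Suc 1) \<le> enat (2 ^ 1 + card {()})"
    proof (rule min_non_DP_colorable_le_cyclic_plus[where e = "\<lambda>_. {Node 0 True, Node 0 False}"
          and p = "\<lambda>_ v. v = Node 0 True"])
      fix g :: "vertex \<Rightarrow> bool" assume "\<And>k. k < 1 \<Longrightarrow> g (Node k True) \<noteq> g (Node k False)"
      then show "\<exists>j\<in>{()}. complies g (\<lambda>v. v = Node 0 True) {Node 0 True, Node 0 False}"
        by (auto simp: complies_def)
    qed auto
    also have "\<dots> \<le> enat (2 ^ (r - 1) + 2 ^ (r div 2))" using 2 by simp
    finally show ?thesis using 2 by (simp add: numeral_2_eq_2)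
  next
    case 3
    define J where "J = {ds :: bool list. length ds = r div 2}"
    have J: "card J = 2 ^ (r div 2)" "finite J"
      using card_lists_length_eq[of "UNIV :: bool set" "r div 2"]
        finite_lists_length_eq[of "UNIV :: bool set" "r div 2"]
      by (auto simp: J_def)
    have "min_non_DP_colorable 2 (Suc (r - 1)) \<le> enat (2 ^ (r - 1) + card J)"
    proof (rule min_non_DP_colorable_le_cyclic_plus[where e = "tree_edge r" and p = tree_pattern])
      show "inj_on (tree_edge r) J" unfolding J_def by (rule inj_on_tree_edge)
      show "finite (tree_edge r j) \<and> card (tree_edge r j) = Suc (r - 1)" if "j \<in> J" for j
        using that card_tree_edge[of j r] 3 by (simp add: J_def)
      show "\<exists>k. Node k True \<in> tree_edge r j \<and> Node k False \<in> tree_edge r j" if "j \<in> J" for j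
        using that pair_in_tree_edge[of j r] 3 by (simp add: J_def)
      show "\<exists>j\<in>J. complies g (tree_pattern j) (tree_edge r j)"
        if "\<And>k. k < r - 1 \<Longrightarrow> g (Node k True) \<noteq> g (Node k False)" for g :: "vertex \<Rightarrow> bool"
        using complies_tree_edge[of r g] that 3 by (auto simp: J_def)
    qed (rule J)
    then show ?thesis using 3 J by simp
  qed
next
  define \<epsilon> :: "nat \<Rightarrow> real" where "\<epsilon> = (\<lambda>r. 2 ^ (r div 2) / 2 ^ (r - 1))"
  have "\<epsilon> \<longlonglongrightarrow> 0"
  proof (rule tendsto_sandwich)
    show "\<forall>\<^sub>F r in sequentially. 0 \<le> \<epsilon> r" by (simp add: \<epsilon>_def)
    \<comment> \<open>The exponents satisfy \<open>2 * (r div 2) \<le> r\<close>, which leaves a decay of \<open>2 ^ (- (r div 2))\<close>.\<close>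
    have "\<epsilon> r \<le> 2 * (1 / 2) ^ (r div 2)" for r
    proof -
      have "(2::real) ^ (r div 2 + r div 2) \<le> 2 ^ Suc (r - 1)" by (intro power_increasing) auto
      then show ?thesis by (simp add: \<epsilon>_def field_simps power_add)
    qed
    then show "\<forall>\<^sub>F r in sequentially. \<epsilon> r \<le> 2 * (1 / 2) ^ (r div 2)" by simp
    have "filterlim (\<lambda>r::nat. r div 2) sequentially sequentially"
      unfolding filterlim_at_top
    proof
      fix Z :: nat
      show "\<forall>\<^sub>F r in sequentially. Z \<le> r div 2"
        using eventually_ge_at_top[of "2 * Z"] by eventually_elim auto
    qed
    moreover have "(\<lambda>k. (1 / 2 :: real) ^ k) \<longlonglongrightarrow> 0" by (rule LIMSEQ_power_zero) simp
    ultimately have "(\<lambda>r. (1 / 2 :: real) ^ (r div 2)) \<longlonglongrightarrow> 0" by (rule filterlim_compose[rotated])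
    then show "(\<lambda>r. 2 * (1 / 2 :: real) ^ (r div 2)) \<longlonglongrightarrow> 0" by (rule tendsto_mult_right_zero)
  qed simp
  moreover have "2 ^ (r - 1) + 2 ^ (r div 2) = (1 + \<epsilon> r) * 2 ^ (r - 1)" for r
    by (simp add: \<epsilon>_def field_simps)
  ultimately show "\<exists>\<epsilon> :: nat \<Rightarrow> real. \<epsilon> \<longlonglongrightarrow> 0 \<and>
      (\<forall>r\<ge>1. 2 ^ (r - 1) + 2 ^ (r div 2) = (1 + \<epsilon> r) * 2 ^ (r - 1))"
    by blast
qed

end
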